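(* Let $(X,\pi;M_X,I_X)$ and $(Y,\sigma;M_Y,I_Y)$ be impulsive semidynamical systems satisfying the standing assumptions. Let $x\in X\setminus M_X$ be almost $\tilde\pi$-periodic and let $y\in Y$. Then the following statements are equivalent: (a) $y$ is strongly comparable with $x$; (b) there is a continuous mapping $h:\overline{\tilde\pi^+(x)}\to\overline{\tilde\sigma^+(y)}$ satisfying $h(\tilde\pi(q,t))=\tilde\sigma(h(q),t)$ for all $q\in\overline{\tilde\pi^+(x)}\setminus M_X$ and $t\in\mathbb R_+$, with $h(x)=y$; (c) $\mathcal L_x\subset\mathcal L_y$.
   Context: Let $\mathbb R_+=[0,+\infty)$. A semidynamical system $(Z,\varrho)$ on a metric space $Z$ is a continuous map $\varrho:Z\times\mathbb R_+\to Z$ with $\varrho(z,0)=z$ and $\varrho(\varrho(z,t),s)=\varrho(z,t+s)$ for all $z\in Z$, $t,s\in\mathbb R_+$. For $z\in Z$, $t\ge 0$ put $F(z,t)=\{w\in Z:\varrho(w,t)=z\}$; for $D\subset Z$, $\Delta\subset[0,+\infty)$ put $F(D,\Delta)=\bigcup_{z\in D,\,t\in\Delta}F(z,t)$ (singletons are written without braces). A point $z$ is an initial point if $F(z,t)=\emptyset$ for all $t>0$. An impulsive semidynamical system (ISS) $(Z,\varrho;M,I)$ consists of a semidynamical system $(Z,\varrho)$, a nonempty closed set $M\subset Z$ such that for every $z\in M$ there is $\epsilon_z>0$ with $F(z,(0,\epsilon_z))\cap M=\emptyset$ and $\varrho(z,(0,\epsilon_z))\cap M=\emptyset$, and a continuous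 function $I:M\to Z$. Let $\phi(z)\in(0,+\infty]$ be the least $s>0$ with $\varrho(z,s)\in M$, and $\phi(z)=+\infty$ if no such $s$ exists. The impulsive trajectory $\tilde\varrho(z,\cdot)$ of $z$ is defined inductively: $z_0^+=z$, $t_0=0$; given $z_n^+$ and $t_n$, if $\phi(z_n^+)=+\infty$ then $\tilde\varrho(z,t)=\varrho(z_n^+,t-t_n)$ for all $t\ge t_n$; otherwise let $s_n=\phi(z_n^+)$, $t_{n+1}=t_n+s_n$, $\tilde\varrho(z,t)=\varrho(z_n^+,t-t_n)$ for $t_n\le t<t_{n+1}$, $z_{n+1}=\varrho(z_n^+,s_n)\in M$, $z_{n+1}^+=I(z_{n+1})$, and $\tilde\varrho(z,t_{n+1})=z_{n+1}^+$. Strong Tube Condition (STC): a point $z\in M$ satisfies STC if there are $\lambda>0$ and closed sets $S,L\subset Z$ with $z\in S$ such that $F(L,\lambda)=S$; $F(L,[0,2\lambda])$ is a neighborhood of $z$; $F(L,\mu)\cap F(L,\nu)=\emptyset$ for $0\le\mu<\nu\le 2\lambda$; and $S=M\cap F(L,[0,2\lambda])$. Standing assumptions on every ISS: no initial point of $(Z,\varrho)$ belongs to $M$ and every element of $M$ satisfies STC (consequently $\phi$ is continuous on $Z\setminus M$); $M\cap I(M)=\emptyset$; and $\tilde\varrho(z,t)$ is defined for all $t\ge 0$ and all $z\in Z$. Here $(X,\rho_X)$ and $(Y,\rho_Y)$ are metric spaces, and $\tilde\pi,\tilde\sigma$ denote the impulsive trajectories in $(X,\pi;M_X,I_X)$ and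 $(Y,\sigma;M_Y,I_Y)$. The impulsive positive orbits are $\tilde\pi^+(x)=\{\tilde\pi(x,t):t\ge0\}$ and $\tilde\sigma^+(y)=\{\tilde\sigma(y,t):t\ge0\}$; the overline denotes closure. A point $x\in X$ is almost $\tilde\pi$-periodic if for every $\epsilon>0$ there is $T=T(\epsilon)>0$ such that for every $\alpha\ge0$ the interval $[\alpha,\alpha+T]$ contains a number $\tau_\alpha>0$ with $\rho_X(\tilde\pi(x,t+\tau_\alpha),\tilde\pi(x,t))<\epsilon$ for all $t\ge0$. For a system $(Z,\varrho;M,I)$ and $z,p\in Z$: $\mathcal L_{z,p}$ is the set of sequences $\{t_n\}_{n\in\mathbb N}\subset\mathbb R_+$ with $\tilde\varrho(z,t_n)\to p$; $\mathcal L_{z,p}^{+\infty}$ is the set of those $\{t_n\}\in\mathcal L_{z,p}$ with $t_n\to+\infty$; $\mathcal L_z=\bigcup_{p\in Z}\mathcal L_{z,p}$ and $\mathcal L_z^{+\infty}=\bigcup_{p\in Z}\mathcal L_{z,p}^{+\infty}$. A point $y\in Y$ is strongly comparable with $x\in X$ if $\mathcal L_{x,x}^{+\infty}\subset\mathcal L_{y,y}^{+\infty}$ and $\mathcal L_x^{+\infty}\subset\mathcal L_y^{+\infty}$. *)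

theory Defs
  imports "HOL-Analysis.Analysis"
begin

text \<open>Throughout, the phase space is a type of class \<open>metric_space\<close>. Time is a real number, and
  only the values of a (semi)flow \<open>\<rho> :: 'a \<Rightarrow> real \<Rightarrow> 'a\<close> at times \<open>t \<ge> 0\<close> are meaningful.\<close>

locale semidynamical_system =
  fixes \<rho> :: "'a::metric_space \<Rightarrow> real \<Rightarrow> 'a"
  assumes continuous_flow: "continuous_on (UNIV \<times> {0..}) (\<lambda>(z, t). \<rho> z t)"
    and flow_zero: "\<rho> z 0 = z"
    and flow_add: "t \<ge> 0 \<Longrightarrow> s \<ge> 0 \<Longrightarrow> \<rho> (\<rho> z t) s = \<rho> z (t + s)"

definition backward :: "('a \<Rightarrow> real \<Rightarrow> 'a) \<Rightarrow> 'a \<Rightarrow> real \<Rightarrow> 'a set" where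
  "backward \<rho> z t = {w. \<rho> w t = z}"

definition backward_set :: "('a \<Rightarrow> real \<Rightarrow> 'a) \<Rightarrow> 'a set \<Rightarrow> real set \<Rightarrow> 'a set" where
  "backward_set \<rho> D \<Delta> = (\<Union>z\<in>D. \<Union>t\<in>\<Delta>. backward \<rho> z t)"

definition initial_point :: "('a \<Rightarrow> real \<Rightarrow> 'a) \<Rightarrow> 'a \<Rightarrow> bool" where
  "initial_point \<rho> z \<longleftrightarrow> (\<forall>t>0. backward \<rho> z t = {})"

locale impulsive_system = semidynamical_system \<rho>
  for \<rho> :: "'a::metric_space \<Rightarrow> real \<Rightarrow> 'a" +
  fixes M :: "'a set" and I :: "'a \<Rightarrow> 'a"
  assumes M_nonempty: "M \<noteq> {}"
    and M_closed: "closed M"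
    and M_isolated: "z \<in> M \<Longrightarrow> \<exists>\<epsilon>>0. backward_set \<rho> {z} {0<..<\<epsilon>} \<inter> M = {}
                                       \<and> \<rho> z ` {0<..<\<epsilon>} \<inter> M = {}"
    and I_continuous: "continuous_on M I"

text \<open>In an impulsive system the minimum below is attained whenever the set of hitting times is
  nonempty.\<close>

definition hitting_time :: "('a \<Rightarrow> real \<Rightarrow> 'a) \<Rightarrow> 'a set \<Rightarrow> 'a \<Rightarrow> ereal" where
  "hitting_time \<rho> M z =
     (if \<exists>s>0. \<rho> z s \<in> M then ereal (LEAST s. s > 0 \<and> \<rho> z s \<in> M) else \<infinity>)"

text \<open>The sequences \<open>z\<^sub>n\<^sup>+\<close> and \<open>t\<^sub>n\<close>. If the construction stops after \<open>z\<^sub>n\<^sup>+\<close>, that is, if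
  \<open>hitting_time \<rho> M z\<^sub>n\<^sup>+ = \<infinity>\<close>, then \<open>t\<^sub>m = \<infinity>\<close> for all \<open>m > n\<close>; the values \<open>z\<^sub>m\<^sup>+\<close> for \<open>m > n\<close> are
  then irrelevant and never enter the trajectory.\<close>

primrec post_impulse :: "('a \<Rightarrow> real \<Rightarrow> 'a) \<Rightarrow> 'a set \<Rightarrow> ('a \<Rightarrow> 'a) \<Rightarrow> 'a \<Rightarrow> nat \<Rightarrow> 'a" where
  "post_impulse \<rho> M I z 0 = z"
| "post_impulse \<rho> M I z (Suc n) =
     I (\<rho> (post_impulse \<rho> M I z n) (real_of_ereal (hitting_time \<rho> M (post_impulse \<rho> M I z n))))"

primrec impulse_time :: "('a \<Rightarrow> real \<Rightarrow> 'a) \<Rightarrow> 'a set \<Rightarrow> ('a \<Rightarrow> 'a) \<Rightarrow> 'a \<Rightarrow> nat \<Rightarrow> ereal" where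
  "impulse_time \<rho> M I z 0 = 0"
| "impulse_time \<rho> M I z (Suc n) =
     impulse_time \<rho> M I z n + hitting_time \<rho> M (post_impulse \<rho> M I z n)"

definition in_stage ::
  "('a \<Rightarrow> real \<Rightarrow> 'a) \<Rightarrow> 'a set \<Rightarrow> ('a \<Rightarrow> 'a) \<Rightarrow> 'a \<Rightarrow> real \<Rightarrow> nat \<Rightarrow> bool" where
  "in_stage \<rho> M I z t n \<longleftrightarrow>
     impulse_time \<rho> M I z n \<le> ereal t \<and> ereal t < impulse_time \<rho> M I z (Suc n)"

definition impulsive_traj ::
  "('a \<Rightarrow> real \<Rightarrow> 'a) \<Rightarrow> 'a set \<Rightarrow> ('a \<Rightarrow> 'a) \<Rightarrow> 'a \<Rightarrow> real \<Rightarrow> 'a" where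
  "impulsive_traj \<rho> M I z t =
     (let n = (THE n. in_stage \<rho> M I z t n)
      in \<rho> (post_impulse \<rho> M I z n) (t - real_of_ereal (impulse_time \<rho> M I z n)))"

definition impulsive_traj_defined ::
  "('a \<Rightarrow> real \<Rightarrow> 'a) \<Rightarrow> 'a set \<Rightarrow> ('a \<Rightarrow> 'a) \<Rightarrow> 'a \<Rightarrow> real \<Rightarrow> bool" where
  "impulsive_traj_defined \<rho> M I z t \<longleftrightarrow> (\<exists>n. in_stage \<rho> M I z t n)"

definition strong_tube_condition ::
  "('a::metric_space \<Rightarrow> real \<Rightarrow> 'a) \<Rightarrow> 'a set \<Rightarrow> 'a \<Rightarrow> bool" where
  "strong_tube_condition \<rho> M z \<longleftrightarrow>
     (\<exists>l>0. \<exists>S L. closed S \<and> closed L \<and> z \<in> S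
        \<and> backward_set \<rho> L {l} = S
        \<and> z \<in> interior (backward_set \<rho> L {0..2 * l})
        \<and> (\<forall>\<mu> \<nu>. 0 \<le> \<mu> \<and> \<mu> < \<nu> \<and> \<nu> \<le> 2 * l \<longrightarrow>
              backward_set \<rho> L {\<mu>} \<inter> backward_set \<rho> L {\<nu>} = {})
        \<and> S = M \<inter> backward_set \<rho> L {0..2 * l})"

text \<open>Impulsive systems satisfying the standing assumptions.\<close>

locale standing_impulsive_system = impulsive_system \<rho> M I
  for \<rho> :: "'a::metric_space \<Rightarrow> real \<Rightarrow> 'a" and M :: "'a set" and I :: "'a \<Rightarrow> 'a" +
  assumes no_initial_point: "z \<in> M \<Longrightarrow> \<not> initial_point \<rho> z"
    and STC: "z \<in> M \<Longrightarrow> strong_tube_condition \<rho> M z"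
    and M_disjoint: "M \<inter> I ` M = {}"
    and traj_defined: "t \<ge> 0 \<Longrightarrow> impulsive_traj_defined \<rho> M I z t"

text \<open>In the remaining definitions \<open>f\<close> stands for an impulsive trajectory map
  \<open>impulsive_traj \<rho> M I\<close>.\<close>

definition positive_orbit :: "('a \<Rightarrow> real \<Rightarrow> 'a) \<Rightarrow> 'a \<Rightarrow> 'a set" where
  "positive_orbit f z = f z ` {0..}"

definition almost_periodic :: "('a::metric_space \<Rightarrow> real \<Rightarrow> 'a) \<Rightarrow> 'a \<Rightarrow> bool" where
  "almost_periodic f x \<longleftrightarrow>
     (\<forall>\<epsilon>>0. \<exists>T>0. \<forall>\<alpha>\<ge>0. \<exists>\<tau>\<in>{\<alpha>..\<alpha> + T}. \<tau> > 0 \<and> (\<forall>t\<ge>0. dist (f x (t + \<tau>)) (f x t) < \<epsilon>))"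

definition conv_times_to :: "('a::metric_space \<Rightarrow> real \<Rightarrow> 'a) \<Rightarrow> 'a \<Rightarrow> 'a \<Rightarrow> (nat \<Rightarrow> real) set" where
  "conv_times_to f z p = {\<theta>. (\<forall>n. \<theta> n \<ge> 0) \<and> (\<lambda>n. f z (\<theta> n)) \<longlonglongrightarrow> p}"

definition conv_times_inf_to ::
  "('a::metric_space \<Rightarrow> real \<Rightarrow> 'a) \<Rightarrow> 'a \<Rightarrow> 'a \<Rightarrow> (nat \<Rightarrow> real) set" where
  "conv_times_inf_to f z p = {\<theta> \<in> conv_times_to f z p. filterlim \<theta> at_top sequentially}"

definition conv_times :: "('a::metric_space \<Rightarrow> real \<Rightarrow> 'a) \<Rightarrow> 'a \<Rightarrow> (nat \<Rightarrow> real) set" where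
  "conv_times f z = (\<Union>p. conv_times_to f z p)"

definition conv_times_inf :: "('a::metric_space \<Rightarrow> real \<Rightarrow> 'a) \<Rightarrow> 'a \<Rightarrow> (nat \<Rightarrow> real) set" where
  "conv_times_inf f z = (\<Union>p. conv_times_inf_to f z p)"

text \<open>\<open>strongly_comparable g y f x\<close>: the point \<open>y\<close> (with trajectories \<open>g\<close>) is strongly comparable
  with the point \<open>x\<close> (with trajectories \<open>f\<close>).\<close>

definition strongly_comparable ::
  "('b::metric_space \<Rightarrow> real \<Rightarrow> 'b) \<Rightarrow> 'b \<Rightarrow> ('a::metric_space \<Rightarrow> real \<Rightarrow> 'a) \<Rightarrow> 'a \<Rightarrow> bool" where
  "strongly_comparable g y f x \<longleftrightarrow>
     conv_times_inf_to f x x \<subseteq> conv_times_inf_to g y y \<and> conv_times_inf f x \<subseteq> conv_times_inf g y"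

end

theory Submission
  imports Defs
begin

text \<open>The strong tube condition makes the hitting time \<open>\<phi>\<close> continuous off \<open>M\<close>, so that
  \<open>(z, t) \<mapsto> \<rho>~(z, t)\<close> is jointly continuous at \<open>(z, t)\<close> whenever \<open>z \<notin> M\<close> and \<open>t > 0\<close> is not an impulse
  time of \<open>z\<close>. Impulse times are avoided by small delays, using right continuity.

  The delicate point is that a limit of the points \<open>\<sigma>~(y, t\<^sub>n)\<close> may lie on \<open>M\<^sub>Y\<close>. If the hitting times
  \<open>\<delta>\<^sub>n\<close> of these points tended to 0, then \<open>\<pi>~(x, t\<^sub>n + \<delta>\<^sub>n)\<close> would have the same limit as
  \<open>\<pi>~(x, t\<^sub>n)\<close>, which lies off \<open>M\<^sub>X\<close>, whereas \<open>\<sigma>~(y, t\<^sub>n + \<delta>\<^sub>n)\<close> would jump from the limit \<open>r\<close> to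
  \<open>I\<^sub>Y r \<noteq> r\<close>; comparability excludes this. Hence trajectories near the limit follow its
  trajectory.

  For (a) to (c), times are moved to infinity along almost periods. For (c) to (b), \<open>h p\<close> is the
  limit of \<open>\<sigma>~(y, t\<^sub>n)\<close> for any times with \<open>\<pi>~(x, t\<^sub>n)\<close> tending to \<open>p\<close>; interlacing two such
  sequences shows that it does not depend on the choice.\<close>

section \<open>Sequences of times, orbit closures and almost periods\<close>

lemma tendsto_dist_le:
  assumes "a \<longlonglongrightarrow> p" "\<epsilon> \<longlonglongrightarrow> 0" "\<And>n. dist (b n) (a n) \<le> \<epsilon> n"
  shows "b \<longlonglongrightarrow> p"
proof -
  have "(\<lambda>n. \<epsilon> n + dist (a n) p) \<longlonglongrightarrow> 0 + 0"
    by (intro tendsto_add assms(2) assms(1)[THEN tendsto_dist_iff[THEN iffD1]])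
  moreover have "dist (b n) p \<le> \<epsilon> n + dist (a n) p" for n
    using assms(3)[of n] dist_triangle[of "b n" p "a n"] by linarith
  ultimately have "(\<lambda>n. dist (b n) p) \<longlonglongrightarrow> 0"
    by (intro tendsto_sandwich[of "\<lambda>_. 0" "\<lambda>n. dist (b n) p"]) auto
  then show ?thesis by (rule tendsto_dist_iff[THEN iffD2])
qed

lemma tendsto_even_odd:
  assumes "a \<longlonglongrightarrow> p" "b \<longlonglongrightarrow> p"
  shows "(\<lambda>n. if even n then a (n div 2) else b (n div 2)) \<longlonglongrightarrow> p"
proof (rule topological_tendstoI)
  fix U assume "open U" "p \<in> U"
  then have "\<forall>\<^sub>F n in sequentially. a n \<in> U" "\<forall>\<^sub>F n in sequentially. b n \<in> U"
    using assms[THEN topological_tendstoD] by simp_all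
  then have "\<forall>\<^sub>F n in sequentially. a n \<in> U \<and> b n \<in> U" by (rule eventually_conj)
  then obtain N where N: "\<And>n. N \<le> n \<Longrightarrow> a n \<in> U \<and> b n \<in> U"
    unfolding eventually_sequentially by blast
  show "\<forall>\<^sub>F n in sequentially. (if even n then a (n div 2) else b (n div 2)) \<in> U"
    unfolding eventually_sequentially
  proof (intro exI allI impI)
    fix n assume "2 * N \<le> n"
    then show "(if even n then a (n div 2) else b (n div 2)) \<in> U" using N[of "n div 2"] by simp
  qed
qed

text \<open>The interlaced times still carry \<open>f x\<close> to \<open>p\<close>, so by
  \<open>sub\<close> they carry \<open>g y\<close> to some limit. The even and odd subsequences
  share that limit, and the even one is known to tend to \<open>r\<close>.\<close>

lemma conv_times_subset_tendsto:
  assumes sub: "conv_times f x \<subseteq> conv_times g y"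
    and "\<And>n. 0 \<le> \<theta> n" "\<And>n. 0 \<le> \<eta> n"
    and "(\<lambda>n. f x (\<theta> n)) \<longlonglongrightarrow> p" "(\<lambda>n. f x (\<eta> n)) \<longlonglongrightarrow> p" "(\<lambda>n. g y (\<theta> n)) \<longlonglongrightarrow> r"
  shows "(\<lambda>n. g y (\<eta> n)) \<longlonglongrightarrow> r"
proof -
  define \<xi> where "\<xi> n = (if even n then \<theta> (n div 2) else \<eta> (n div 2))" for n
  have "(\<lambda>n. f x (\<xi> n)) \<longlonglongrightarrow> p"
    using tendsto_even_odd[OF assms(4,5)] unfolding \<xi>_def by (simp add: if_distrib)
  then have "\<xi> \<in> conv_times f x"
    using assms(2,3) unfolding conv_times_def conv_times_to_def \<xi>_def by auto
  then obtain r' where r': "(\<lambda>n. g y (\<xi> n)) \<longlonglongrightarrow> r'"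
    using sub unfolding conv_times_def conv_times_to_def by blast
  have "strict_mono (\<lambda>n::nat. 2 * n)" "strict_mono (\<lambda>n::nat. Suc (2 * n))"
    by (simp_all add: strict_mono_def)
  from this[THEN LIMSEQ_subseq_LIMSEQ[OF r']]
  have "(\<lambda>n. g y (\<theta> n)) \<longlonglongrightarrow> r'" "(\<lambda>n. g y (\<eta> n)) \<longlonglongrightarrow> r'"
    by (simp_all add: o_def \<xi>_def)
  then show ?thesis using LIMSEQ_unique assms(6) by blast
qed

text \<open>Divergence of the times does not involve the limit point. Hence an inclusion between the
  sets \<open>conv_times\<close> passes directly to the sets \<open>conv_times_inf\<close>.\<close>

lemma conv_times_inf_eq:
  "conv_times_inf f z = {\<theta> \<in> conv_times f z. filterlim \<theta> at_top sequentially}"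
  unfolding conv_times_inf_def conv_times_inf_to_def conv_times_def by auto

lemma in_closure_positive_orbit:
  fixes f :: "'a::metric_space \<Rightarrow> real \<Rightarrow> 'a"
  shows "p \<in> closure (positive_orbit f z) \<longleftrightarrow> (\<exists>\<theta>. (\<forall>n. 0 \<le> \<theta> n) \<and> (\<lambda>n. f z (\<theta> n)) \<longlonglongrightarrow> p)"
    (is "?L \<longleftrightarrow> ?R")
proof
  assume ?L
  then obtain a where a: "\<forall>n. a n \<in> positive_orbit f z" "a \<longlonglongrightarrow> p"
    unfolding closure_sequential by (elim exE conjE)
  then have "\<forall>n. \<exists>t. 0 \<le> t \<and> a n = f z t" unfolding positive_orbit_def by fastforce
  from choice[OF this] obtain \<theta> where "\<forall>n. 0 \<le> \<theta> n \<and> a n = f z (\<theta> n)" ..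
  moreover from this have "a = (\<lambda>n. f z (\<theta> n))" by auto
  ultimately show ?R using a(2) by auto
next
  assume ?R
  then obtain \<theta> where "\<forall>n. 0 \<le> \<theta> n" "(\<lambda>n. f z (\<theta> n)) \<longlonglongrightarrow> p" by (elim exE conjE)
  then show ?L
    unfolding closure_sequential positive_orbit_def
    by (intro exI[of _ "\<lambda>n. f z (\<theta> n)"]) auto
qed

text \<open>The core of (b) to (c). A limit \<open>p\<close> of orbit points is carried to
  \<open>h p\<close> by continuity of \<open>h\<close> on the closure; the intertwining identity is
  used on the orbit of \<open>x\<close> alone, so \<open>p\<close> may lie on an impulse
  set.\<close>

lemma conv_times_semiconjugate:
  assumes "continuous_on (closure (positive_orbit f x)) h" "\<And>t. 0 \<le> t \<Longrightarrow> h (f x t) = g y t"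
  shows "conv_times f x \<subseteq> conv_times g y"
proof
  fix \<theta> assume "\<theta> \<in> conv_times f x"
  then obtain p where p: "\<And>n. 0 \<le> \<theta> n" "(\<lambda>n. f x (\<theta> n)) \<longlonglongrightarrow> p"
    unfolding conv_times_def conv_times_to_def by auto
  have "f x (\<theta> n) \<in> positive_orbit f x" for n
    unfolding positive_orbit_def using p(1) by auto
  then have orb: "f x (\<theta> n) \<in> closure (positive_orbit f x)" for n
    using closure_subset by blast
  have "p \<in> closure (positive_orbit f x)"
    using p unfolding in_closure_positive_orbit by blast
  then have "(\<lambda>n. h (f x (\<theta> n))) \<longlonglongrightarrow> h p"
    by (rule continuous_on_tendsto_compose[OF assms(1) p(2)]) (simp add: orb)
  then show "\<theta> \<in> conv_times g y"
    using p(1) assms(2) unfolding conv_times_def conv_times_to_def by auto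
qed

text \<open>The window of length T is started at \<open>real n\<close> while the tolerance shrinks
  with \<open>n\<close>: almost periods of increasing quality that tend to infinity.\<close>

lemma almost_periodicE:
  assumes "almost_periodic f x"
  obtains \<tau> where "\<And>n. real n \<le> \<tau> n"
    "\<And>n t. 0 \<le> t \<Longrightarrow> dist (f x (t + \<tau> n)) (f x t) < inverse (Suc n)"
proof -
  have "\<exists>\<tau>\<ge>real n. \<forall>t\<ge>0. dist (f x (t + \<tau>)) (f x t) < inverse (Suc n)" for n
  proof -
    have "0 < inverse (real (Suc n))" by simp
    then obtain T where "\<forall>\<alpha>\<ge>0. \<exists>\<tau>\<in>{\<alpha>..\<alpha> + T}. \<tau> > 0 \<and>
        (\<forall>t\<ge>0. dist (f x (t + \<tau>)) (f x t) < inverse (Suc n))"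
      using assms unfolding almost_periodic_def by blast
    from this[rule_format, of "real n"] show ?thesis by auto
  qed
  then show ?thesis using that by metis
qed

lemma isCont_nhdsI: "(f \<longlongrightarrow> f a) (nhds a) \<Longrightarrow> isCont f a"
  unfolding isCont_def tendsto_at_iff_tendsto_nhds .

section \<open>Hitting times and the stages of an impulsive trajectory\<close>

context impulsive_system
begin

abbreviation \<phi> :: "'a \<Rightarrow> ereal" where
  "\<phi> z \<equiv> hitting_time \<rho> M z"

abbreviation \<psi> :: "'a \<Rightarrow> real \<Rightarrow> 'a" where
  "\<psi> \<equiv> impulsive_traj \<rho> M I"

lemma flow_tendsto:
  assumes "(a \<longlongrightarrow> z) F" "(b \<longlongrightarrow> t) F" "\<forall>\<^sub>F n in F. 0 \<le> b n" "0 \<le> t"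
  shows "((\<lambda>n. \<rho> (a n) (b n)) \<longlongrightarrow> \<rho> z t) F"
proof -
  have "((\<lambda>n. (\<lambda>(z, t). \<rho> z t) (a n, b n)) \<longlongrightarrow> (\<lambda>(z, t). \<rho> z t) (z, t)) F"
    by (rule continuous_on_tendsto_compose[OF continuous_flow tendsto_Pair[OF assms(1,2)]])
      (use assms in auto)
  then show ?thesis by simp
qed

lemma continuous_on_flow: "continuous_on {0..} (\<rho> z)"
  unfolding continuous_on_def
  by (auto intro!: flow_tendsto tendsto_intros simp: eventually_at_filter)

text \<open>On \<open>M\<close> this is the isolation axiom; off \<open>M\<close> it is closedness
  of \<open>M\<close> and continuity of the flow at time 0. It keeps the infimum of the hitting
  times positive.\<close>

lemma no_immediate_hit: "\<exists>e>0. \<forall>u. 0 < u \<and> u < e \<longrightarrow> \<rho> z u \<notin> M"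
proof (cases "z \<in> M")
  case True
  then show ?thesis using M_isolated[OF True] by force
next
  case False
  have "((\<lambda>u. \<rho> z u) \<longlongrightarrow> \<rho> z 0) (at_right 0)"
    by (intro flow_tendsto tendsto_intros) (auto simp: eventually_at_filter)
  moreover have "open (- M)" "\<rho> z 0 \<in> - M" using M_closed False flow_zero by auto
  ultimately have "\<forall>\<^sub>F u in at_right 0. \<rho> z u \<in> - M" by (rule topological_tendstoD)
  then show ?thesis unfolding eventually_at_right_field by auto
qed

lemma hitting_time_finite:
  assumes "\<exists>s>0. \<rho> z s \<in> M"
  shows "\<exists>s>0. \<phi> z = ereal s \<and> \<rho> z s \<in> M \<and> (\<forall>u. 0 < u \<and> u < s \<longrightarrow> \<rho> z u \<notin> M)"
proof -
  obtain e where e: "e > 0" "\<And>u. 0 < u \<Longrightarrow> u < e \<Longrightarrow> \<rho> z u \<notin> M"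
    using no_immediate_hit[of z] by auto
  \<comment> \<open>The condition \<open>s > 0\<close> is not closed; cutting at \<open>e\<close>
    loses no hit and makes the set of hits closed, so its infimum is attained and is the
    \<open>LEAST\<close> of the definition.\<close>
  define H where "H = {e..} \<inter> \<rho> z -` M"
  have H: "H = {s. s > 0 \<and> \<rho> z s \<in> M}" unfolding H_def using e by force
  have "closed H" unfolding H_def
    by (rule continuous_closed_preimage[OF continuous_on_subset[OF continuous_on_flow]])
      (use e M_closed in auto)
  moreover have "H \<noteq> {}" using assms H by auto
  moreover have "bdd_below H" unfolding H_def by (rule bdd_belowI[of _ e]) simp
  ultimately have "Inf H \<in> H" by (intro closed_contains_Inf)
  moreover have "u \<notin> H" if "u < Inf H" for u
    using that cInf_lower[OF _ \<open>bdd_below H\<close>] by force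
  moreover have "(LEAST s. s > 0 \<and> \<rho> z s \<in> M) = Inf H"
    by (rule Least_equality)
      (use \<open>Inf H \<in> H\<close> \<open>bdd_below H\<close> cInf_lower[of _ H] in \<open>auto simp: H\<close>)
  then have "\<phi> z = ereal (Inf H)" unfolding hitting_time_def using assms by simp
  ultimately show ?thesis unfolding H by auto
qed

lemma hitting_time_infinite_iff: "\<phi> z = \<infinity> \<longleftrightarrow> (\<forall>s>0. \<rho> z s \<notin> M)"
  unfolding hitting_time_def by auto

lemma hitting_time_cases:
  obtains "\<phi> z = \<infinity>" | s where "s > 0" "\<phi> z = ereal s"
  using hitting_time_finite[of z] hitting_time_infinite_iff[of z] by blast

lemma hitting_time_pos: "\<phi> z > 0"
  by (cases z rule: hitting_time_cases) auto

lemma flow_at_hitting_time: "\<phi> z = ereal s \<Longrightarrow> \<rho> z s \<in> M"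
  using hitting_time_finite[of z] hitting_time_infinite_iff[of z] by force

lemma flow_before_hitting_time: "0 < u \<Longrightarrow> ereal u < \<phi> z \<Longrightarrow> \<rho> z u \<notin> M"
  using hitting_time_finite[of z] by force

lemma hitting_time_le: "0 < s \<Longrightarrow> \<rho> z s \<in> M \<Longrightarrow> \<phi> z \<le> ereal s"
  using flow_before_hitting_time[of s z] by force

lemma hitting_time_eqI:
  assumes "0 < s" "\<rho> z s \<in> M" "\<And>u. 0 < u \<Longrightarrow> u < s \<Longrightarrow> \<rho> z u \<notin> M"
  shows "\<phi> z = ereal s"
  using hitting_time_finite[of z] assms by (metis linorder_neqE_linordered_idom)

lemma hitting_time_flow_infinite:
  assumes "\<phi> z = \<infinity>" "0 \<le> t"
  shows "\<phi> (\<rho> z t) = \<infinity>"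
  using assms unfolding hitting_time_infinite_iff by (auto simp: flow_add)

lemma hitting_time_flow:
  assumes "\<phi> z = ereal s" "0 \<le> t" "t < s"
  shows "\<phi> (\<rho> z t) = ereal (s - t)"
proof (rule hitting_time_eqI)
  show "\<rho> (\<rho> z t) (s - t) \<in> M"
    using assms flow_at_hitting_time[of z s] by (simp add: flow_add)
  show "\<rho> (\<rho> z t) u \<notin> M" if "0 < u" "u < s - t" for u
    using that assms flow_before_hitting_time[of "t + u" z] by (simp add: flow_add)
qed (use assms in auto)

lemma impulse_time_nonneg: "0 \<le> impulse_time \<rho> M I z n"
  by (induction n) (auto simp: less_imp_le[OF hitting_time_pos] intro!: add_nonneg_nonneg)

lemma impulse_time_mono: "m \<le> n \<Longrightarrow> impulse_time \<rho> M I z m \<le> impulse_time \<rho> M I z n"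
proof (rule lift_Suc_mono_le[of "impulse_time \<rho> M I z"])
  show "impulse_time \<rho> M I z n \<le> impulse_time \<rho> M I z (Suc n)" for n
    using less_imp_le[OF hitting_time_pos] by (simp add: add_increasing2)
qed

lemma in_stage_unique:
  assumes "in_stage \<rho> M I z t m" "in_stage \<rho> M I z t n"
  shows "m = n"
proof -
  have "\<not> m < n" if "in_stage \<rho> M I z t m" "in_stage \<rho> M I z t n" for m n
    using that impulse_time_mono[of "Suc m" n z] unfolding in_stage_def
    by (metis Suc_leI leD le_less_trans order.trans)
  then show ?thesis using assms by (meson linorder_neqE_nat)
qed

lemma impulsive_traj_stage:
  assumes "in_stage \<rho> M I z t n"
  shows "\<psi> z t = \<rho> (post_impulse \<rho> M I z n) (t - real_of_ereal (impulse_time \<rho> M I z n))"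
proof -
  have "(THE n. in_stage \<rho> M I z t n) = n" using assms in_stage_unique by blast
  then show ?thesis unfolding impulsive_traj_def by simp
qed

lemma in_stage_0: "in_stage \<rho> M I z t 0 \<longleftrightarrow> 0 \<le> t \<and> ereal t < \<phi> z"
  unfolding in_stage_def by (auto simp: zero_ereal_def)

text \<open>The definitions recurse at the last impulse. This lemma and the next two peel off the
  first one instead, so that a trajectory can be restarted at \<open>I (\<rho> z s)\<close>.\<close>

lemma post_impulse_shift:
  assumes "\<phi> z = ereal s"
  shows "post_impulse \<rho> M I z (Suc n) = post_impulse \<rho> M I (I (\<rho> z s)) n"
  by (induction n) (use assms in auto)

lemma impulse_time_shift:
  assumes "\<phi> z = ereal s"
  shows "impulse_time \<rho> M I z (Suc n) = ereal s + impulse_time \<rho> M I (I (\<rho> z s)) n"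
proof (induction n)
  case (Suc n)
  then show ?case using post_impulse_shift[OF assms, of n] by (simp add: add.assoc)
qed (use assms in auto)

lemma in_stage_Suc:
  assumes "\<phi> z = ereal s"
  shows "in_stage \<rho> M I z t (Suc n) \<longleftrightarrow> in_stage \<rho> M I (I (\<rho> z s)) (t - s) n"
  unfolding in_stage_def impulse_time_shift[OF assms]
  using impulse_time_nonneg[of "I (\<rho> z s)" n] impulse_time_nonneg[of "I (\<rho> z s)" "Suc n"]
  by (cases "impulse_time \<rho> M I (I (\<rho> z s)) n"; cases "impulse_time \<rho> M I (I (\<rho> z s)) (Suc n)")
    (auto simp del: impulse_time.simps)

section \<open>Trajectories before their first impulse\<close>

lemma impulsive_traj_flow:
  assumes "0 \<le> t" "ereal t < \<phi> z"
  shows "\<psi> z t = \<rho> z t"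
  using impulsive_traj_stage[of z t 0] assms in_stage_0 by simp

lemma impulsive_traj_zero: "\<psi> z 0 = z"
  using impulsive_traj_flow[of 0 z] hitting_time_pos[of z] flow_zero by (simp add: zero_ereal_def)

text \<open>By compactness of \<open>K\<close>, the points whose orbit meets \<open>C\<close> at a
  time in \<open>K\<close> form a closed set: the meeting times have a convergent
  subsequence.\<close>

lemma flow_avoids_closed:
  assumes "compact K" "K \<subseteq> {0..}" "closed C" "\<And>t. t \<in> K \<Longrightarrow> \<rho> z t \<notin> C"
  shows "\<forall>\<^sub>F w in nhds z. \<forall>t\<in>K. \<rho> w t \<notin> C"
proof -
  have "closed {w. \<exists>t\<in>K. \<rho> w t \<in> C}"
    unfolding closed_sequential_limits
  proof (intro allI impI, elim conjE)
    fix w l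
    assume w: "\<forall>n. w n \<in> {w. \<exists>t\<in>K. \<rho> w t \<in> C}" and l: "w \<longlonglongrightarrow> l"
    obtain t where t: "\<And>n. t n \<in> K" "\<And>n. \<rho> (w n) (t n) \<in> C" using w by (simp; metis)
    obtain t0 r where r: "t0 \<in> K" "strict_mono r" "(t \<circ> r) \<longlonglongrightarrow> t0"
      using assms(1) t(1) unfolding compact_def by metis
    have "(\<lambda>n. \<rho> ((w \<circ> r) n) ((t \<circ> r) n)) \<longlonglongrightarrow> \<rho> l t0"
      by (intro flow_tendsto LIMSEQ_subseq_LIMSEQ[OF l r(2)] r(3))
        (use t(1) r(1) assms(2) in \<open>auto intro!: always_eventually\<close>)
    then have "\<rho> l t0 \<in> C"
      by (rule closed_sequentially[OF assms(3), rotated]) (simp add: t(2))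
    then show "l \<in> {w. \<exists>t\<in>K. \<rho> w t \<in> C}" using r(1) by blast
  qed
  then have "open (- {w. \<exists>t\<in>K. \<rho> w t \<in> C})" by (rule open_Compl)
  then have "\<forall>\<^sub>F w in nhds z. w \<in> - {w. \<exists>t\<in>K. \<rho> w t \<in> C}"
    by (rule eventually_nhds_in_open) (use assms(4) in auto)
  then show ?thesis by eventually_elim auto
qed

text \<open>The compact set of times is \<open>{0..a}\<close>. Time 0 belongs to it, and there the
  orbit avoids \<open>M\<close> because \<open>z\<close> does; near a point of \<open>M\<close>,
  points slightly upstream could hit at once.\<close>

lemma hitting_time_lower_semicontinuous:
  assumes "z \<notin> M" "ereal a < \<phi> z"
  shows "\<forall>\<^sub>F w in nhds z. ereal a < \<phi> w"
proof -
  have "\<forall>\<^sub>F w in nhds z. \<forall>t\<in>{0..a}. \<rho> w t \<notin> M"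
  proof (rule flow_avoids_closed)
    fix t assume "t \<in> {0..a}"
    then show "\<rho> z t \<notin> M"
      using assms flow_zero flow_before_hitting_time[of t z] le_less_trans[of "ereal t" "ereal a"]
      by (cases "t = 0") auto
  qed (use M_closed in auto)
  then show ?thesis
  proof eventually_elim
    case (elim w)
    then show ?case
      by (cases w rule: hitting_time_cases) (use flow_at_hitting_time[of w] in force)+
  qed
qed

text \<open>Lower semicontinuity provides a time \<open>c > t\<close> before which no nearby point
  jumps, so all trajectories concerned are still given by the continuous flow.\<close>

lemma impulsive_traj_tendsto_flow:
  assumes "(a \<longlongrightarrow> z) F" "(b \<longlongrightarrow> t) F" "\<forall>\<^sub>F n in F. 0 \<le> b n" "0 \<le> t"
    and "z \<notin> M" "ereal t < \<phi> z"
  shows "((\<lambda>n. \<psi> (a n) (b n)) \<longlongrightarrow> \<psi> z t) F"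
proof -
  obtain c where c: "t < c" "ereal c < \<phi> z" using ereal_dense2[OF assms(6)] by auto
  have "\<forall>\<^sub>F n in F. ereal c < \<phi> (a n)"
    using hitting_time_lower_semicontinuous[OF assms(5) c(2)] assms(1)
    by (rule eventually_compose_filterlim)
  moreover have "\<forall>\<^sub>F n in F. b n < c" using order_tendstoD(2)[OF assms(2) c(1)] .
  ultimately have "\<forall>\<^sub>F n in F. \<rho> (a n) (b n) = \<psi> (a n) (b n)"
    using assms(3)
  proof eventually_elim
    case (elim n)
    then have "ereal (b n) < \<phi> (a n)" by (meson ereal_less_eq(3) less_imp_le le_less_trans)
    then show ?case using elim by (simp add: impulsive_traj_flow)
  qed
  moreover have "((\<lambda>n. \<rho> (a n) (b n)) \<longlongrightarrow> \<rho> z t) F" by (intro flow_tendsto assms)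
  ultimately show ?thesis
    using impulsive_traj_flow[OF assms(4,6)] by (simp add: tendsto_cong)
qed

end

lemma in_backward_set: "w \<in> backward_set \<rho> D \<Delta> \<longleftrightarrow> (\<exists>t\<in>\<Delta>. \<rho> w t \<in> D)"
  unfolding backward_set_def backward_def by auto

section \<open>The semigroup law of impulsive trajectories\<close>

context standing_impulsive_system
begin

text \<open>Stage \<open>n\<close> of the restarted trajectory is stage \<open>n + 1\<close> of the
  original one; such a stage exists because trajectories are defined for all times.\<close>

lemma impulsive_traj_jump:
  assumes "\<phi> z = ereal s" "0 \<le> t"
  shows "\<psi> z (s + t) = \<psi> (I (\<rho> z s)) t"
proof -
  obtain n where n: "in_stage \<rho> M I (I (\<rho> z s)) t n"
    using traj_defined[OF assms(2)] unfolding impulsive_traj_defined_def by blast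
  then have "in_stage \<rho> M I z (s + t) (Suc n)" by (simp add: in_stage_Suc[OF assms(1)])
  moreover obtain r where "impulse_time \<rho> M I (I (\<rho> z s)) n = ereal r"
    using n impulse_time_nonneg[of "I (\<rho> z s)" n] unfolding in_stage_def
    by (cases "impulse_time \<rho> M I (I (\<rho> z s)) n") auto
  ultimately show ?thesis
    using impulsive_traj_stage[OF n] impulsive_traj_stage[of z "s + t" "Suc n"]
      post_impulse_shift[OF assms(1), of n] impulse_time_shift[OF assms(1), of n]
    by (simp del: post_impulse.simps impulse_time.simps)
qed

text \<open>Every time lies in some stage, so induction on the stage number reaches it. Since
  \<open>z\<close> is generalised, each jump may replace it by its post-impulse point.\<close>

lemma impulsive_traj_induct [consumes 1, case_names flow jump]:
  assumes "0 \<le> t"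
    and flow: "\<And>z t. 0 \<le> t \<Longrightarrow> ereal t < \<phi> z \<Longrightarrow> P z t"
    and jump: "\<And>z s t. 0 < s \<Longrightarrow> \<phi> z = ereal s \<Longrightarrow> 0 \<le> t \<Longrightarrow> P (I (\<rho> z s)) t \<Longrightarrow> P z (s + t)"
  shows "P z t"
proof -
  have "P z t" if "in_stage \<rho> M I z t n" for n
    using that
  proof (induction n arbitrary: z t)
    case 0
    then show ?case using flow by (simp add: in_stage_0)
  next
    case (Suc n)
    show ?case
    proof (cases z rule: hitting_time_cases)
      case 1
      \<comment> \<open>Without a hit all impulse times after the zeroth are infinite, so no real
        time lies in stage \<open>Suc n\<close>.\<close>
      have "impulse_time \<rho> M I z (Suc 0) \<le> impulse_time \<rho> M I z (Suc n)"
        by (rule impulse_time_mono) simp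
      then have "impulse_time \<rho> M I z (Suc n) = \<infinity>" using 1 by simp
      then show ?thesis using Suc.prems unfolding in_stage_def
        by (simp del: impulse_time.simps)
    next
      case (2 s)
      have *: "in_stage \<rho> M I (I (\<rho> z s)) (t - s) n" using Suc.prems in_stage_Suc[OF 2(2)] by simp
      then have "0 \<le> t - s"
        using impulse_time_nonneg[of "I (\<rho> z s)" n] unfolding in_stage_def
        by (metis ereal_less_eq(5) order.trans)
      then have "P z (s + (t - s))" using jump[OF 2] Suc.IH[OF *] by blast
      then show ?thesis by simp
    qed
  qed
  then show ?thesis
    using traj_defined[OF assms(1), of z] unfolding impulsive_traj_defined_def by blast
qed

lemma impulsive_traj_add:
  assumes "0 \<le> t" "0 \<le> r"
  shows "\<psi> (\<psi> z t) r = \<psi> z (t + r)"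
  using assms(1)
proof (induction z t rule: impulsive_traj_induct)
  case (flow z t)
  then have eq: "\<psi> z t = \<rho> z t" by (rule impulsive_traj_flow)
  show ?case
  proof (cases z rule: hitting_time_cases)
    case 1
    then show ?thesis
      using flow assms(2) eq hitting_time_flow_infinite by (simp add: impulsive_traj_flow flow_add)
  next
    case (2 s)
    then have \<phi>: "\<phi> (\<rho> z t) = ereal (s - t)" using hitting_time_flow flow by simp
    show ?thesis
    proof (cases "r < s - t")
      case True
      then show ?thesis using flow assms(2) eq \<phi> 2 by (simp add: impulsive_traj_flow flow_add)
    next
      case False
      \<comment> \<open>Past the impulse both sides restart from the same point with the same time
        left.\<close>
      have "\<psi> (\<rho> z t) (s - t + (r - (s - t))) = \<psi> (I (\<rho> (\<rho> z t) (s - t))) (r - (s - t))"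
        by (rule impulsive_traj_jump[OF \<phi>]) (use False in simp)
      moreover have "\<psi> z (s + (r - (s - t))) = \<psi> (I (\<rho> z s)) (r - (s - t))"
        by (rule impulsive_traj_jump[OF 2(2)]) (use False in simp)
      moreover have "\<rho> (\<rho> z t) (s - t) = \<rho> z s" using flow 2 by (simp add: flow_add)
      ultimately show ?thesis using eq by (simp add: algebra_simps)
    qed
  qed
next
  case (jump z s t)
  then show ?case
    using impulsive_traj_jump[OF jump(2), of t] impulsive_traj_jump[OF jump(2), of "t + r"] assms(2)
    by (simp add: add.assoc)
qed

section \<open>Continuity of hitting times and of impulsive trajectories\<close>

lemma post_impulse_notin: "\<phi> z = ereal s \<Longrightarrow> I (\<rho> z s) \<notin> M"
  using M_disjoint flow_at_hitting_time[of z s] by blast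

text \<open>At an impulse time the trajectory takes its post-impulse value, so from the right only a
  piece of the continuous flow is seen.\<close>

lemma impulsive_traj_right_continuous:
  assumes "0 \<le> t"
  shows "((\<lambda>d. \<psi> z (t + d)) \<longlongrightarrow> \<psi> z t) (at_right 0)"
  using assms
proof (induction z t rule: impulsive_traj_induct)
  case (flow z t)
  have "((\<lambda>d. t + d) \<longlongrightarrow> t + 0) (at_right 0)" by (intro tendsto_intros)
  then have lim: "((\<lambda>d. t + d) \<longlongrightarrow> t) (at_right 0)" by simp
  have nn: "\<forall>\<^sub>F d in at_right (0::real). 0 \<le> t + d"
    using flow by (auto simp: eventually_at_filter)
  have "((\<lambda>d. ereal (t + d)) \<longlongrightarrow> ereal t) (at_right 0)" using lim by (rule tendsto_ereal)
  then have "\<forall>\<^sub>F d in at_right 0. ereal (t + d) < \<phi> z" using flow by (intro order_tendstoD(2))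
  then have ev: "\<forall>\<^sub>F d in at_right 0. \<rho> z (t + d) = \<psi> z (t + d)"
    using nn by eventually_elim (simp add: impulsive_traj_flow)
  have "((\<lambda>d. \<rho> z (t + d)) \<longlongrightarrow> \<rho> z t) (at_right 0)"
    using lim nn flow by (intro flow_tendsto) auto
  then show ?case using tendsto_cong[OF ev] impulsive_traj_flow[OF flow] by simp
next
  case (jump z s t)
  have "\<forall>\<^sub>F d in at_right (0::real). \<psi> (I (\<rho> z s)) (t + d) = \<psi> z (s + t + d)"
    using jump impulsive_traj_jump[OF jump(2)]
    by (auto simp: eventually_at_filter add.assoc)
  then show ?case
    using jump impulsive_traj_jump[OF jump(2), of t] by (simp add: tendsto_cong)
qed


text \<open>Orbits starting near \<open>z\<close> enter the tube around \<open>\<rho> z s\<close> at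
  a time \<open>s'\<close> just before \<open>s\<close>, so they reach \<open>L\<close>. The
  disjoint sections force the arrival to occur between \<open>s' + l\<close> and
  \<open>b + l\<close>; the section a time \<open>l\<close> earlier is \<open>S\<close>, which lies
  in \<open>M\<close>.\<close>

lemma hitting_time_upper_semicontinuous:
  assumes "0 < s" "\<phi> z = ereal s" "s < b"
  shows "\<forall>\<^sub>F w in nhds z. \<phi> w < ereal b"
proof -
  obtain l S L where l: "l > 0" and L: "closed L" and S: "\<rho> z s \<in> S" "backward_set \<rho> L {l} = S"
    and U: "\<rho> z s \<in> interior (backward_set \<rho> L {0..2 * l})"
    and disj: "\<And>\<mu> \<nu>. 0 \<le> \<mu> \<Longrightarrow> \<mu> < \<nu> \<Longrightarrow> \<nu> \<le> 2 * l \<Longrightarrow>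
      backward_set \<rho> L {\<mu>} \<inter> backward_set \<rho> L {\<nu>} = {}"
    and SM: "S = M \<inter> backward_set \<rho> L {0..2 * l}"
    using STC[OF flow_at_hitting_time[OF assms(2)]] unfolding strong_tube_condition_def
    by (elim exE conjE) metis
  define U where "U = interior (backward_set \<rho> L {0..2 * l})"
  \<comment> \<open>The entry time \<open>s'\<close> is taken with \<open>s - l < s'\<close>, so
    that the arrival of \<open>z\<close> at \<open>L\<close>, at time \<open>s + l\<close>, has tube
    coordinate strictly between \<open>l\<close> and \<open>2 * l\<close>.\<close>
  have "((\<lambda>t. \<rho> z t) \<longlongrightarrow> \<rho> z s) (at_left s)"
    using assms(1) eventually_at_left_real[of 0 s]
    by (intro flow_tendsto tendsto_intros) (auto elim: eventually_mono)
  then have "\<forall>\<^sub>F t in at_left s. \<rho> z t \<in> U"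
    by (rule topological_tendstoD) (use U in \<open>auto simp: U_def\<close>)
  moreover have "\<forall>\<^sub>F t in at_left s. t \<in> {max 0 (s - l)<..<s}"
    by (rule eventually_at_left_real) (use l assms(1) in auto)
  ultimately have "\<forall>\<^sub>F t in at_left s. \<rho> z t \<in> U \<and> t \<in> {max 0 (s - l)<..<s}"
    by (rule eventually_conj)
  then obtain s' where s': "\<rho> z s' \<in> U" "0 < s'" "s - l < s'" "s' < s"
    using eventually_happens'[OF trivial_limit_at_left_real] by fastforce
  have "\<rho> z (s + l) \<in> L" using S assms(1) l by (auto simp: in_backward_set flow_add)
  then have Ls: "\<rho> z s' \<in> backward_set \<rho> L {s + l - s'}"
    using s' l by (simp add: in_backward_set flow_add)
  define K where "K = {s'..s' + l} \<union> {max s' (b + l)..s' + 2 * l}"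
  \<comment> \<open>\<open>K\<close> leaves only the times in \<open>(s' + l, b + l)\<close> for reaching \<open>L\<close>; the orbit meets \<open>M\<close> a time
    \<open>l\<close> earlier.\<close>
  have "\<forall>\<^sub>F w in nhds z. \<forall>t\<in>K. \<rho> w t \<notin> L"
  proof (rule flow_avoids_closed)
    show "compact K" "K \<subseteq> {0..}" unfolding K_def using s' by auto
    fix t assume t: "t \<in> K"
    show "\<rho> z t \<notin> L"
    proof
      assume "\<rho> z t \<in> L"
      then have "\<rho> z s' \<in> backward_set \<rho> L {t - s'}"
        using s' t unfolding K_def by (auto simp: in_backward_set flow_add)
      \<comment> \<open>An arrival during \<open>K\<close> would give \<open>\<rho> z s'\<close> a
        second tube coordinate, smaller or larger according to the piece of
        \<open>K\<close>.\<close>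
      moreover have "0 \<le> t - s' \<and> t - s' < s + l - s' \<and> s + l - s' \<le> 2 * l
          \<or> 0 \<le> s + l - s' \<and> s + l - s' < t - s' \<and> t - s' \<le> 2 * l"
        using t s' assms(3) l unfolding K_def by auto
      ultimately show False using disj Ls by blast
    qed
  qed (rule L)
  moreover have "\<forall>\<^sub>F w in nhds z. \<rho> w s' \<in> U"
  proof (rule topological_tendstoD)
    show "((\<lambda>w. \<rho> w s') \<longlongrightarrow> \<rho> z s') (nhds z)"
      using s' by (intro flow_tendsto filterlim_ident tendsto_const) auto
  qed (use s' in \<open>auto simp: U_def\<close>)
  ultimately show ?thesis
  proof eventually_elim
    case (elim w)
    then have "\<rho> w s' \<in> backward_set \<rho> L {0..2 * l}"
      using interior_subset unfolding U_def by blast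
    then obtain \<mu> where "0 \<le> \<mu>" "\<mu> \<le> 2 * l" "\<rho> (\<rho> w s') \<mu> \<in> L"
      unfolding in_backward_set by auto
    then have \<mu>: "0 \<le> \<mu>" "\<mu> \<le> 2 * l" "\<rho> w (s' + \<mu>) \<in> L"
      using s'(2) by (simp_all add: flow_add)
    then have "s' + \<mu> \<notin> K" using elim by blast
    then have *: "l < \<mu>" "s' + \<mu> - l < b" using \<mu> unfolding K_def by auto
    then have "\<rho> w (s' + \<mu> - l) \<in> S"
      using \<mu> s' l unfolding S(2)[symmetric] in_backward_set by (simp add: flow_add)
    then have "\<rho> w (s' + \<mu> - l) \<in> M" using SM by blast
    then have "\<phi> w \<le> ereal (s' + \<mu> - l)" using * s' by (intro hitting_time_le) auto
    then show ?case using * le_less_trans[of "\<phi> w" "ereal (s' + \<mu> - l)"] by simp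
  qed
qed

lemma hitting_time_tendsto:
  assumes "z \<notin> M" "0 < s" "\<phi> z = ereal s"
  shows "(\<phi> \<longlongrightarrow> ereal s) (nhds z)"
proof (rule order_tendstoI)
  fix a assume a: "a < ereal s"
  show "\<forall>\<^sub>F w in nhds z. a < \<phi> w"
  proof (cases a)
    case (real r)
    then show ?thesis using hitting_time_lower_semicontinuous[OF assms(1), of r] a assms by simp
  next
    case MInf
    have "a < \<phi> w" for w using MInf less_trans[OF _ hitting_time_pos, of a w] by simp
    then show ?thesis by simp
  qed (use a in simp)
next
  fix b assume "ereal s < b"
  then obtain r where "s < r" "ereal r < b" using ereal_dense2[of "ereal s" b] by auto
  then show "\<forall>\<^sub>F w in nhds z. \<phi> w < b"
    using hitting_time_upper_semicontinuous[OF assms(2,3), of r]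
    by (auto elim!: eventually_mono intro: less_trans)
qed

text \<open>Joint continuity may fail at impulse times, hence the small positive delay. Across the
  first impulse, the post-impulse point and the time left depend continuously on starting point and
  time, so continuity is inherited from the restarted trajectory, which again starts off
  \<open>M\<close>.\<close>

lemma impulsive_traj_isCont:
  assumes "0 \<le> t" "z \<notin> M"
  shows "\<forall>\<^sub>F d in at_right 0. isCont (\<lambda>p. \<psi> (fst p) (snd p)) (z, t + d)"
  using assms
proof (induction z t rule: impulsive_traj_induct)
  case (flow z t)
  obtain c where c: "t < c" "ereal c < \<phi> z" using ereal_dense2[OF flow(2)] by auto
  have "\<forall>\<^sub>F d in at_right 0. d \<in> {0<..<c - t}"
    by (rule eventually_at_right_real) (use c in simp)
  then show ?case
  proof eventually_elim
    case (elim d)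
    have "((\<lambda>p. \<psi> (fst p) (snd p)) \<longlongrightarrow> \<psi> z (t + d)) (nhds (z, t + d))"
    proof (rule impulsive_traj_tendsto_flow)
      show lim: "(fst \<longlongrightarrow> z) (nhds (z, t + d))" "(snd \<longlongrightarrow> t + d) (nhds (z, t + d))"
        using tendsto_fst[OF filterlim_ident] tendsto_snd[OF filterlim_ident] by fastforce+
      show "\<forall>\<^sub>F p in nhds (z, t + d). 0 \<le> snd p"
        using order_tendstoD(1)[OF lim(2), of 0] elim flow(1) by (auto elim: eventually_mono)
      show "ereal (t + d) < \<phi> z" using elim c(2) by (auto intro: less_trans[of _ "ereal c"])
    qed (use elim flow in auto)
    then show ?case by (intro isCont_nhdsI) simp
  qed
next
  case (jump z s t)
  define v where "v = I (\<rho> z s)"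
  have pos: "\<forall>\<^sub>F d in at_right 0. d > (0::real)" by (simp add: eventually_at_filter)
  have "\<forall>\<^sub>F d in at_right 0. isCont (\<lambda>p. \<psi> (fst p) (snd p)) (v, t + d)"
    unfolding v_def using jump post_impulse_notin by blast
  then show ?case using pos
  proof eventually_elim
    case (elim d)
    let ?F = "nhds (z, s + t + d)"
    \<comment> \<open>The real number \<open>u p\<close> represents the hitting time only where that
      is finite; \<open>eq\<close> secures this near \<open>z\<close>.\<close>
    define u where "u = (\<lambda>p::'a \<times> real. real_of_ereal (\<phi> (fst p)))"
    have lim: "(fst \<longlongrightarrow> z) ?F" "(snd \<longlongrightarrow> s + t + d) ?F"
      using tendsto_fst[OF filterlim_ident] tendsto_snd[OF filterlim_ident] by fastforce+
    have \<phi>: "((\<lambda>p. \<phi> (fst p)) \<longlongrightarrow> ereal s) ?F"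
      using filterlim_compose[OF hitting_time_tendsto lim(1)] jump by blast
    then have u: "(u \<longlongrightarrow> s) ?F" unfolding u_def by (rule lim_real_of_ereal)
    have "\<forall>\<^sub>F p in ?F. \<phi> (fst p) < \<infinity>" by (rule order_tendstoD(2)[OF \<phi>]) simp
    then have eq: "\<forall>\<^sub>F p in ?F. \<phi> (fst p) = ereal (u p) \<and> 0 < u p"
    proof eventually_elim
      case (elim p)
      then show ?case unfolding u_def by (cases "fst p" rule: hitting_time_cases) auto
    qed
    have hit: "((\<lambda>p. \<rho> (fst p) (u p)) \<longlongrightarrow> \<rho> z s) ?F"
      using eq jump by (intro flow_tendsto lim u) (auto elim: eventually_mono)
    have "((\<lambda>p. I (\<rho> (fst p) (u p))) \<longlongrightarrow> v) ?F" unfolding v_def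
      by (rule continuous_on_tendsto_compose[OF I_continuous hit])
        (use eq flow_at_hitting_time jump in \<open>auto elim!: eventually_mono\<close>)
    moreover have dif: "((\<lambda>p. snd p - u p) \<longlongrightarrow> t + d) ?F"
      using tendsto_diff[OF lim(2) u] by (simp add: algebra_simps)
    ultimately have "((\<lambda>p. (I (\<rho> (fst p) (u p)), snd p - u p)) \<longlongrightarrow> (v, t + d)) ?F"
      by (rule tendsto_Pair)
    from isCont_tendsto_compose[OF elim(1) this]
    have "((\<lambda>p. \<psi> (I (\<rho> (fst p) (u p))) (snd p - u p)) \<longlongrightarrow> \<psi> v (t + d)) ?F" by simp
    moreover have "\<psi> z (s + t + d) = \<psi> v (t + d)"
      using impulsive_traj_jump[OF jump(2), of "t + d"] jump elim unfolding v_def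
      by (simp add: add.assoc)
    moreover have "\<forall>\<^sub>F p in ?F. 0 < snd p - u p"
      by (rule order_tendstoD(1)[OF dif]) (use jump elim in simp)
    then have "\<forall>\<^sub>F p in ?F. \<psi> (I (\<rho> (fst p) (u p))) (snd p - u p) = \<psi> (fst p) (snd p)"
      using eq
    proof eventually_elim
      case (elim p)
      then show ?case using impulsive_traj_jump[of "fst p" "u p" "snd p - u p"] by simp
    qed
    ultimately show ?case
      by (intro isCont_nhdsI) (simp add: tendsto_cong)
  qed
qed

text \<open>Here \<open>r\<close> may lie on \<open>M\<close>. The assumption \<open>stable\<close>
  excludes jumps of the \<open>w n\<close> after vanishing delays, so all late \<open>w n\<close>
  flow freely for a common time \<open>c\<close>; at time \<open>c\<close> the trajectory of
  \<open>r\<close> is off \<open>M\<close> and joint continuity takes over.\<close>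

lemma impulsive_traj_shadow:
  assumes stable: "\<And>k \<delta>. strict_mono k \<Longrightarrow> (\<And>n. 0 \<le> \<delta> n) \<Longrightarrow> \<delta> \<longlonglongrightarrow> 0 \<Longrightarrow>
      (\<lambda>n. \<psi> (w (k n)) (\<delta> n)) \<longlonglongrightarrow> r"
    and "0 \<le> t"
  shows "\<forall>\<^sub>F d in at_right 0. (\<lambda>n. \<psi> (w n) (t + d)) \<longlonglongrightarrow> \<psi> r (t + d)"
proof -
  have w: "w \<longlonglongrightarrow> r"
    using stable[of id "\<lambda>_. 0"] by (simp add: impulsive_traj_zero strict_mono_id)
  obtain c0 where c0: "0 < c0" "ereal c0 < \<phi> r"
    using ereal_dense2[OF hitting_time_pos[of r]] by (auto simp: zero_ereal_def)
  have "\<exists>c>0. ereal c < \<phi> r \<and> (\<forall>\<^sub>F n in sequentially. ereal c < \<phi> (w n))"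
  proof (cases "r \<in> M")
    case False
    then have "\<forall>\<^sub>F n in sequentially. ereal c0 < \<phi> (w n)"
      using eventually_compose_filterlim[OF hitting_time_lower_semicontinuous w] c0 by blast
    then show ?thesis using c0 by blast
  next
    case True
    show ?thesis
    proof (rule ccontr)
      assume neg: "\<not> ?thesis"
      \<comment> \<open>Taking the minimum with \<open>c0\<close> keeps the bound below
        \<open>\<phi> r\<close>, as the negated claim demands.\<close>
      have small: "\<exists>n>N. \<phi> (w n) \<le> ereal c" if "0 < c" for c N
      proof (rule ccontr)
        assume "\<not> ?thesis"
        then have "\<forall>\<^sub>F n in sequentially. ereal (min c c0) < \<phi> (w n)"
          using le_less_trans[of "ereal (min c c0)" "ereal c"] unfolding eventually_sequentially
          by (intro exI[of _ "Suc N"]) (auto simp: not_le)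
        moreover have "ereal (min c c0) < \<phi> r"
          using c0 le_less_trans[of "ereal (min c c0)" "ereal c0"] by simp
        moreover have "0 < min c c0" using that c0 by simp
        ultimately show False using neg by blast
      qed
      have "\<exists>k. \<forall>n. \<phi> (w (k n)) \<le> ereal (inverse (Suc n)) \<and> k n < k (Suc n)"
      proof (rule dependent_nat_choice)
        show "\<exists>j. \<phi> (w j) \<le> ereal (inverse (Suc 0))" using small[of "inverse (Suc 0)"] by auto
        show "\<exists>j. \<phi> (w j) \<le> ereal (inverse (Suc (Suc n))) \<and> i < j" for i n
          using small[of "inverse (Suc (Suc n))" i] by (auto simp del: of_nat_Suc)
      qed
      then obtain k where k: "\<And>n. \<phi> (w (k n)) \<le> ereal (inverse (Suc n))" "\<And>n. k n < k (Suc n)"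
        by blast
      define \<delta> where "\<delta> = (\<lambda>n. real_of_ereal (\<phi> (w (k n))))"
      have \<delta>: "\<phi> (w (k n)) = ereal (\<delta> n) \<and> 0 \<le> \<delta> n \<and> \<delta> n \<le> inverse (Suc n)" for n
        unfolding \<delta>_def using k(1)[of n]
        by (cases "w (k n)" rule: hitting_time_cases) (auto simp del: of_nat_Suc)
      have k_mono: "strict_mono k" using k(2) by (simp add: strict_mono_Suc_iff)
      have \<delta>_lim: "\<delta> \<longlonglongrightarrow> 0"
        by (rule tendsto_sandwich[OF _ _ tendsto_const LIMSEQ_inverse_real_of_nat])
          (use \<delta> in \<open>auto simp del: of_nat_Suc\<close>)
      \<comment> \<open>Along \<open>k\<close> the points hit \<open>M\<close> near \<open>r\<close>
        and jump to near \<open>I r\<close>; \<open>stable\<close> gives the limit \<open>r\<close>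
        instead, although \<open>I\<close> has no fixed point on \<open>M\<close>.\<close>
      have "(\<lambda>n. \<rho> ((w \<circ> k) n) (\<delta> n)) \<longlonglongrightarrow> \<rho> r 0"
        by (intro flow_tendsto LIMSEQ_subseq_LIMSEQ w k_mono \<delta>_lim) (use \<delta> in auto)
      then have hit: "(\<lambda>n. \<rho> (w (k n)) (\<delta> n)) \<longlonglongrightarrow> r" by (simp add: flow_zero)
      have "(\<lambda>n. I (\<rho> (w (k n)) (\<delta> n))) \<longlonglongrightarrow> I r"
        by (rule continuous_on_tendsto_compose[OF I_continuous hit True])
          (use \<delta> flow_at_hitting_time in auto)
      moreover have "I (\<rho> (w (k n)) (\<delta> n)) = \<psi> (w (k n)) (\<delta> n)" for n
        using impulsive_traj_jump[of "w (k n)" "\<delta> n" 0] \<delta>[of n] by (simp add: impulsive_traj_zero)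
      ultimately have "(\<lambda>n. \<psi> (w (k n)) (\<delta> n)) \<longlonglongrightarrow> I r" by simp
      moreover have "(\<lambda>n. \<psi> (w (k n)) (\<delta> n)) \<longlonglongrightarrow> r"
        by (rule stable[OF k_mono _ \<delta>_lim]) (use \<delta> in blast)
      ultimately have "I r = r" by (rule LIMSEQ_unique)
      then show False using True M_disjoint by force
    qed
  qed
  then obtain c where c: "0 < c" "ereal c < \<phi> r" "\<forall>\<^sub>F n in sequentially. ereal c < \<phi> (w n)"
    by blast
  have early: "(\<lambda>n. \<psi> (w n) a) \<longlonglongrightarrow> \<psi> r a" if "0 \<le> a" "a \<le> c" for a
  proof -
    have *: "ereal a < \<phi> z" if "ereal c < \<phi> z" for z
      using \<open>a \<le> c\<close> that le_less_trans[of "ereal a" "ereal c"] by simp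
    have "\<forall>\<^sub>F n in sequentially. \<rho> (w n) a = \<psi> (w n) a"
      using c(3) by eventually_elim (simp add: impulsive_traj_flow * that)
    moreover have "(\<lambda>n. \<rho> (w n) a) \<longlonglongrightarrow> \<rho> r a" by (intro flow_tendsto w) (use that in auto)
    ultimately show ?thesis
      using impulsive_traj_flow[OF that(1) *[OF c(2)]] by (simp add: tendsto_cong)
  qed
  show ?thesis
  proof (cases "t < c")
    case True
    then have "\<forall>\<^sub>F d in at_right 0. d \<in> {0<..<c - t}" by (intro eventually_at_right_real) simp
    then show ?thesis by eventually_elim (use early assms(2) in auto)
  next
    case False
    have pos: "\<forall>\<^sub>F d in at_right 0. d > (0::real)" by (simp add: eventually_at_filter)
    have "\<psi> r c \<notin> M"
      using c flow_before_hitting_time[of c r] by (simp add: impulsive_traj_flow)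
    then have "\<forall>\<^sub>F d in at_right 0. isCont (\<lambda>p. \<psi> (fst p) (snd p)) (\<psi> r c, t - c + d)"
      using False by (intro impulsive_traj_isCont) auto
    then show ?thesis using pos
    proof eventually_elim
      case (elim d)
      have "(\<lambda>n. (\<psi> (w n) c, t - c + d)) \<longlonglongrightarrow> (\<psi> r c, t - c + d)"
        using c by (intro tendsto_Pair early tendsto_const) auto
      from isCont_tendsto_compose[OF elim(1) this] show ?case
        using c elim False by (simp add: impulsive_traj_add)
    qed
  qed
qed

end

section \<open>Two systems: the implications between (a), (b) and (c)\<close>

locale impulsive_system_pair =
  X: standing_impulsive_system \<pi> M\<^sub>X I\<^sub>X + Y: standing_impulsive_system \<sigma> M\<^sub>Y I\<^sub>Y
  for \<pi> :: "'a::metric_space \<Rightarrow> real \<Rightarrow> 'a" and M\<^sub>X :: "'a set" and I\<^sub>X :: "'a \<Rightarrow> 'a"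
    and \<sigma> :: "'b::metric_space \<Rightarrow> real \<Rightarrow> 'b" and M\<^sub>Y :: "'b set" and I\<^sub>Y :: "'b \<Rightarrow> 'b"
begin

abbreviation f :: "'a \<Rightarrow> real \<Rightarrow> 'a" where
  "f \<equiv> impulsive_traj \<pi> M\<^sub>X I\<^sub>X"

abbreviation g :: "'b \<Rightarrow> real \<Rightarrow> 'b" where
  "g \<equiv> impulsive_traj \<sigma> M\<^sub>Y I\<^sub>Y"

text \<open>Because \<open>q\<close> is off \<open>M\<^sub>X\<close>, vanishing delays do not change
  the limit of \<open>f x (s n)\<close>. The assumption \<open>comp\<close> transfers this to
  \<open>g y\<close>, which is the stability required for shadowing; both (a) and (c) can supply
  it.\<close>

lemma tendsto_shift_of_comparable:
  assumes q: "q \<notin> M\<^sub>X" and s: "\<And>n. 0 \<le> s n" "(\<lambda>n. f x (s n)) \<longlonglongrightarrow> q"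
    and comp: "\<And>k \<delta>. strict_mono k \<Longrightarrow> (\<And>n. 0 \<le> \<delta> n) \<Longrightarrow> (\<lambda>n. f x (s (k n) + \<delta> n)) \<longlonglongrightarrow> q \<Longrightarrow>
      (\<lambda>n. g y (s (k n) + \<delta> n)) \<longlonglongrightarrow> r"
    and "0 \<le> t"
  shows "\<forall>\<^sub>F d in at_right 0. (\<lambda>n. g y (s n + (t + d))) \<longlonglongrightarrow> g r (t + d)"
proof -
  have "\<forall>\<^sub>F d in at_right 0. (\<lambda>n. g (g y (s n)) (t + d)) \<longlonglongrightarrow> g r (t + d)"
  proof (rule Y.impulsive_traj_shadow[OF _ \<open>0 \<le> t\<close>])
    fix k :: "nat \<Rightarrow> nat" and \<delta> :: "nat \<Rightarrow> real"
    assume k: "strict_mono k" and \<delta>: "\<And>n. 0 \<le> \<delta> n" "\<delta> \<longlonglongrightarrow> 0"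
    have "(\<lambda>n. f (((\<lambda>n. f x (s n)) \<circ> k) n) (\<delta> n)) \<longlonglongrightarrow> f q 0"
      by (intro X.impulsive_traj_tendsto_flow LIMSEQ_subseq_LIMSEQ s k q \<delta>)
        (use \<delta> X.hitting_time_pos[of q] in \<open>auto simp: zero_ereal_def\<close>)
    then have "(\<lambda>n. f x (s (k n) + \<delta> n)) \<longlonglongrightarrow> q"
      using s \<delta> by (simp add: X.impulsive_traj_add X.impulsive_traj_zero)
    then show "(\<lambda>n. g (g y (s (k n))) (\<delta> n)) \<longlonglongrightarrow> r"
      using comp[OF k \<delta>(1)] s \<delta> by (simp add: Y.impulsive_traj_add)
  qed
  moreover have "\<forall>\<^sub>F d in at_right 0. d > (0::real)" by (simp add: eventually_at_filter)
  ultimately show ?thesis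
    by eventually_elim (use s \<open>0 \<le> t\<close> in \<open>simp add: Y.impulsive_traj_add\<close>)
qed

text \<open>The times \<open>\<theta> n\<close> need not diverge, so they are replaced by times
  \<open>s n\<close> at least \<open>n\<close> at which both trajectories are close to their values
  at \<open>\<theta> n\<close>; (a) applies to \<open>s\<close>.\<close>

lemma strongly_comparable_imp_subset:
  assumes x: "x \<notin> M\<^sub>X" and ap: "almost_periodic f x" and sc: "strongly_comparable g y f x"
  shows "conv_times f x \<subseteq> conv_times g y"
proof
  fix \<theta> assume "\<theta> \<in> conv_times f x"
  then obtain p where \<theta>: "\<And>n. 0 \<le> \<theta> n" "(\<lambda>n. f x (\<theta> n)) \<longlonglongrightarrow> p"
    unfolding conv_times_def conv_times_to_def by auto
  obtain \<tau> where \<tau>: "\<And>n. real n \<le> \<tau> n"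
    "\<And>n t. 0 \<le> t \<Longrightarrow> dist (f x (t + \<tau> n)) (f x t) < inverse (Suc n)"
    by (rule almost_periodicE[OF ap]) blast
  have \<tau>0: "0 \<le> \<tau> n" for n using \<tau>(1)[of n] by linarith
  have \<tau>_inf: "filterlim \<tau> at_top sequentially"
    by (rule filterlim_at_top_mono[OF filterlim_real_sequentially]) (use \<tau>(1) in auto)
  have "(\<lambda>n. f x (\<tau> n)) \<longlonglongrightarrow> x"
    by (rule tendsto_dist_le[OF tendsto_const LIMSEQ_inverse_real_of_nat])
      (use \<tau>(2)[of 0] in \<open>auto simp: X.impulsive_traj_zero less_imp_le simp del: of_nat_Suc\<close>)
  note recur = tendsto_shift_of_comparable[OF x \<tau>0 this]
  \<comment> \<open>The first inclusion in (a) makes \<open>g y\<close> return to \<open>y\<close>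
    along the almost periods of \<open>x\<close>, so \<open>g y\<close> nearly repeats itself after
    them.\<close>
  have shadow: "\<forall>\<^sub>F d in at_right 0. (\<lambda>k. g y (\<tau> k + (t + d))) \<longlonglongrightarrow> g y (t + d)" if "0 \<le> t" for t
  proof (rule recur[OF _ that])
    fix k :: "nat \<Rightarrow> nat" and \<delta> :: "nat \<Rightarrow> real"
    assume k: "strict_mono k" and \<delta>: "\<And>n. 0 \<le> \<delta> n"
      and lim: "(\<lambda>n. f x (\<tau> (k n) + \<delta> n)) \<longlonglongrightarrow> x"
    have "filterlim (\<lambda>n. \<tau> (k n)) at_top sequentially"
      using filterlim_compose[OF \<tau>_inf filterlim_subseq[OF k]] .
    then have "filterlim (\<lambda>n. \<tau> (k n) + \<delta> n) at_top sequentially"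
      by (rule filterlim_at_top_mono) (use \<delta> in auto)
    then have "(\<lambda>n. \<tau> (k n) + \<delta> n) \<in> conv_times_inf_to f x x"
      using lim \<tau>0 \<delta> unfolding conv_times_inf_to_def conv_times_to_def by auto
    then have "(\<lambda>n. \<tau> (k n) + \<delta> n) \<in> conv_times_inf_to g y y"
      using sc unfolding strongly_comparable_def by blast
    then show "(\<lambda>n. g y (\<tau> (k n) + \<delta> n)) \<longlonglongrightarrow> y"
      unfolding conv_times_inf_to_def conv_times_to_def by simp
  qed
  have "\<forall>n. \<exists>s. real n \<le> s \<and> dist (f x s) (f x (\<theta> n)) \<le> 2 * inverse (Suc n) \<and>
      dist (g y s) (g y (\<theta> n)) \<le> 2 * inverse (Suc n)"
  proof
    fix n
    define e where "e = inverse (real (Suc n))"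
    have e: "e > 0" unfolding e_def by simp
    have "\<forall>\<^sub>F d in at_right 0. d > (0::real)" by (simp add: eventually_at_filter)
    moreover note shadow[OF \<theta>(1)[of n]]
    moreover have "\<forall>\<^sub>F d in at_right 0. dist (f x (\<theta> n + d)) (f x (\<theta> n)) < e"
      by (rule tendstoD[OF X.impulsive_traj_right_continuous[OF \<theta>(1)] e])
    moreover have "\<forall>\<^sub>F d in at_right 0. dist (g y (\<theta> n + d)) (g y (\<theta> n)) < e"
      by (rule tendstoD[OF Y.impulsive_traj_right_continuous[OF \<theta>(1)] e])
    ultimately have "\<forall>\<^sub>F d in at_right 0. d > (0::real) \<and>
        (\<lambda>k. g y (\<tau> k + (\<theta> n + d))) \<longlonglongrightarrow> g y (\<theta> n + d) \<and>
        dist (f x (\<theta> n + d)) (f x (\<theta> n)) < e \<and> dist (g y (\<theta> n + d)) (g y (\<theta> n)) < e"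
      by eventually_elim blast
    then obtain d where d: "d > 0" "(\<lambda>k. g y (\<tau> k + (\<theta> n + d))) \<longlonglongrightarrow> g y (\<theta> n + d)"
      "dist (f x (\<theta> n + d)) (f x (\<theta> n)) < e" "dist (g y (\<theta> n + d)) (g y (\<theta> n)) < e"
      using eventually_happens'[OF trivial_limit_at_right_real] by blast
    obtain N where N: "\<And>k. N \<le> k \<Longrightarrow> dist (g y (\<tau> k + (\<theta> n + d))) (g y (\<theta> n + d)) < e"
      using tendstoD[OF d(2) e] unfolding eventually_sequentially by blast
    \<comment> \<open>The bound \<open>N\<close> controls \<open>g\<close>, while \<open>n\<close>
      controls \<open>f\<close> and divergence. The delay \<open>d\<close> and the shift
      \<open>\<tau> k\<close> each cost at most \<open>e\<close>, hence the factor 2.\<close>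
    define k where "k = max n N"
    let ?s = "\<theta> n + d + \<tau> k"
    have "inverse (real (Suc k)) \<le> e" unfolding e_def k_def by (intro le_imp_inverse_le) auto
    then have "dist (f x ?s) (f x (\<theta> n + d)) < e"
      using \<tau>(2)[of "\<theta> n + d" k] \<theta>(1)[of n] d(1) by linarith
    moreover have "dist (g y ?s) (g y (\<theta> n + d)) < e"
      using N[of k] unfolding k_def by (simp add: add.commute)
    moreover have "real n \<le> ?s" using \<tau>(1)[of k] \<theta>(1)[of n] d(1) unfolding k_def by simp
    moreover have "dist (f x ?s) (f x (\<theta> n))
        \<le> dist (f x ?s) (f x (\<theta> n + d)) + dist (f x (\<theta> n + d)) (f x (\<theta> n))"
      "dist (g y ?s) (g y (\<theta> n))
        \<le> dist (g y ?s) (g y (\<theta> n + d)) + dist (g y (\<theta> n + d)) (g y (\<theta> n))"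
      by (rule dist_triangle)+
    ultimately have "real n \<le> ?s \<and> dist (f x ?s) (f x (\<theta> n)) \<le> 2 * e \<and>
        dist (g y ?s) (g y (\<theta> n)) \<le> 2 * e"
      using d(3,4) by (intro conjI) linarith+
    then show "\<exists>s. real n \<le> s \<and> dist (f x s) (f x (\<theta> n)) \<le> 2 * inverse (Suc n) \<and>
        dist (g y s) (g y (\<theta> n)) \<le> 2 * inverse (Suc n)"
      unfolding e_def by (rule exI)
  qed
  from choice[OF this] obtain s where s: "\<And>n. real n \<le> s n"
    "\<And>n. dist (f x (s n)) (f x (\<theta> n)) \<le> 2 * inverse (Suc n)"
    "\<And>n. dist (g y (s n)) (g y (\<theta> n)) \<le> 2 * inverse (Suc n)"
    by blast
  have e0: "(\<lambda>n. 2 * inverse (real (Suc n))) \<longlonglongrightarrow> 0"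
    by (rule tendsto_mult_right_zero[OF LIMSEQ_inverse_real_of_nat])
  have "filterlim s at_top sequentially"
    by (rule filterlim_at_top_mono[OF filterlim_real_sequentially]) (use s(1) in auto)
  moreover have "(\<lambda>n. f x (s n)) \<longlonglongrightarrow> p" using tendsto_dist_le[OF \<theta>(2) e0 s(2)] .
  moreover have "0 \<le> s n" for n using s(1)[of n] by linarith
  ultimately have "s \<in> conv_times_inf f x"
    unfolding conv_times_inf_def conv_times_inf_to_def conv_times_to_def by auto
  then have "s \<in> conv_times g y"
    using sc unfolding strongly_comparable_def conv_times_inf_eq by blast
  then obtain q where q: "(\<lambda>n. g y (s n)) \<longlonglongrightarrow> q"
    unfolding conv_times_def conv_times_to_def by auto
  have "(\<lambda>n. g y (\<theta> n)) \<longlonglongrightarrow> q"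
    by (rule tendsto_dist_le[OF q e0]) (use s(3) in \<open>simp add: dist_commute\<close>)
  then show "\<theta> \<in> conv_times g y"
    using \<theta>(1) unfolding conv_times_def conv_times_to_def by auto
qed

text \<open>The constant times 0 give the limits \<open>x\<close> and \<open>y\<close>; comparison
  with them identifies the limit of \<open>g y\<close> along any times returning to
  \<open>x\<close>.\<close>

lemma subset_imp_strongly_comparable:
  assumes "conv_times f x \<subseteq> conv_times g y"
  shows "strongly_comparable g y f x"
proof -
  have "\<theta> \<in> conv_times_inf_to g y y" if "\<theta> \<in> conv_times_inf_to f x x" for \<theta>
  proof -
    have \<theta>: "\<And>n. 0 \<le> \<theta> n" "(\<lambda>n. f x (\<theta> n)) \<longlonglongrightarrow> x" "filterlim \<theta> at_top sequentially"
      using that unfolding conv_times_inf_to_def conv_times_to_def by auto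
    have "(\<lambda>n. g y (\<theta> n)) \<longlonglongrightarrow> y"
      by (rule conv_times_subset_tendsto[OF assms, of "\<lambda>_. 0", OF _ \<theta>(1) _ \<theta>(2)])
        (simp_all add: X.impulsive_traj_zero Y.impulsive_traj_zero)
    then show ?thesis using \<theta> unfolding conv_times_inf_to_def conv_times_to_def by simp
  qed
  moreover have "conv_times_inf f x \<subseteq> conv_times_inf g y"
    using assms unfolding conv_times_inf_eq by auto
  ultimately show ?thesis unfolding strongly_comparable_def by blast
qed

lemma subset_imp_semiconjugate:
  assumes sub: "conv_times f x \<subseteq> conv_times g y"
  shows "\<exists>h. continuous_on (closure (positive_orbit f x)) h
    \<and> h ` closure (positive_orbit f x) \<subseteq> closure (positive_orbit g y)
    \<and> (\<forall>q \<in> closure (positive_orbit f x) - M\<^sub>X. \<forall>t\<ge>0. h (f q t) = g (h q) t) \<and> h x = y"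
proof -
  define C where "C = closure (positive_orbit f x)"
  have C_I: "p \<in> C" if "\<And>n. 0 \<le> \<theta> n" "(\<lambda>n. f x (\<theta> n)) \<longlonglongrightarrow> p" for p \<theta>
    unfolding C_def in_closure_positive_orbit using that by blast
  have C_E: "\<exists>\<theta>. (\<forall>n. 0 \<le> \<theta> n) \<and> (\<lambda>n. f x (\<theta> n)) \<longlonglongrightarrow> p" if "p \<in> C" for p
    using that unfolding C_def in_closure_positive_orbit .
  have "\<exists>r. \<forall>\<theta>. (\<forall>n. 0 \<le> \<theta> n) \<longrightarrow> (\<lambda>n. f x (\<theta> n)) \<longlonglongrightarrow> p \<longrightarrow> (\<lambda>n. g y (\<theta> n)) \<longlonglongrightarrow> r"
    if p: "p \<in> C" for p
  proof -
    obtain \<eta> where \<eta>: "\<And>n. 0 \<le> \<eta> n" "(\<lambda>n. f x (\<eta> n)) \<longlonglongrightarrow> p" using C_E[OF p] by blast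
    then obtain r where "(\<lambda>n. g y (\<eta> n)) \<longlonglongrightarrow> r"
      using sub unfolding conv_times_def conv_times_to_def by blast
    then show ?thesis using conv_times_subset_tendsto[OF sub \<eta>(1) _ \<eta>(2)] by blast
  qed
  then obtain h where h: "\<And>p \<theta>. p \<in> C \<Longrightarrow> (\<And>n. 0 \<le> \<theta> n) \<Longrightarrow> (\<lambda>n. f x (\<theta> n)) \<longlonglongrightarrow> p \<Longrightarrow>
      (\<lambda>n. g y (\<theta> n)) \<longlonglongrightarrow> h p"
    by metis
  have h_image: "h ` C \<subseteq> closure (positive_orbit g y)"
  proof
    fix r assume "r \<in> h ` C"
    then obtain p where p: "p \<in> C" "r = h p" by blast
    obtain \<theta> where \<theta>: "\<And>n. 0 \<le> \<theta> n" "(\<lambda>n. f x (\<theta> n)) \<longlonglongrightarrow> p" using C_E[OF p(1)] by blast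
    then show "r \<in> closure (positive_orbit g y)"
      using h[OF p(1) \<theta>] p(2) unfolding in_closure_positive_orbit by blast
  qed
  have "(\<lambda>_. g y 0) \<longlonglongrightarrow> h x"
    by (rule h) (use C_I[of "\<lambda>_. 0"] in \<open>auto simp: X.impulsive_traj_zero\<close>)
  then have h_x: "h x = y" by (simp add: LIMSEQ_const_iff Y.impulsive_traj_zero)
  have h_cont: "continuous_on C h"
    unfolding continuous_on_sequentially
  proof (intro allI ballI impI, elim conjE)
    fix u p assume p: "p \<in> C" and u: "\<forall>n. u n \<in> C" "u \<longlonglongrightarrow> p"
    \<comment> \<open>Each \<open>u n\<close> is replaced by an orbit point close to it whose
      partner on the orbit of \<open>y\<close> is close to \<open>h (u n)\<close>, so the defining
      property of \<open>h\<close> applies at \<open>p\<close>.\<close>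
    have "\<exists>s\<ge>0. dist (f x s) (u n) \<le> inverse (Suc n) \<and> dist (g y s) (h (u n)) \<le> inverse (Suc n)" for n
    proof -
      have e: "0 < inverse (real (Suc n))" by simp
      obtain \<theta> where \<theta>: "\<And>n. 0 \<le> \<theta> n" "(\<lambda>m. f x (\<theta> m)) \<longlonglongrightarrow> u n" using C_E u(1) by blast
      have "(\<lambda>m. g y (\<theta> m)) \<longlonglongrightarrow> h (u n)" using h \<theta> u(1) by blast
      from eventually_conj[OF tendstoD[OF \<theta>(2) e] tendstoD[OF this e]]
      obtain m where "dist (f x (\<theta> m)) (u n) < inverse (Suc n)"
        "dist (g y (\<theta> m)) (h (u n)) < inverse (Suc n)"
        unfolding eventually_sequentially by blast
      then show ?thesis using \<theta>(1) less_imp_le by blast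
    qed
    then obtain s where s: "\<And>n. 0 \<le> s n" "\<And>n. dist (f x (s n)) (u n) \<le> inverse (Suc n)"
      "\<And>n. dist (g y (s n)) (h (u n)) \<le> inverse (Suc n)"
      by metis
    have "(\<lambda>n. f x (s n)) \<longlonglongrightarrow> p"
      using tendsto_dist_le[OF u(2) LIMSEQ_inverse_real_of_nat s(2)] .
    then have "(\<lambda>n. g y (s n)) \<longlonglongrightarrow> h p" using h p s(1) by blast
    then have "(\<lambda>n. h (u n)) \<longlonglongrightarrow> h p"
      by (rule tendsto_dist_le[OF _ LIMSEQ_inverse_real_of_nat]) (use s(3) in \<open>simp add: dist_commute\<close>)
    then show "(h \<circ> u) \<longlonglongrightarrow> h p" by (simp add: o_def)
  qed
  \<comment> \<open>The identity is first obtained at \<open>t + d\<close>, where joint continuity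
    for \<open>f\<close> and shadowing for \<open>g\<close> give the two limits. Letting
    \<open>d\<close> tend to 0 then uses right continuity of both trajectories and continuity of
    \<open>h\<close>.\<close>
  have "h (f q t) = g (h q) t" if q: "q \<in> C" "q \<notin> M\<^sub>X" and t: "0 \<le> t" for q t
  proof -
    obtain \<theta> where \<theta>: "\<And>n. 0 \<le> \<theta> n" "(\<lambda>n. f x (\<theta> n)) \<longlonglongrightarrow> q" using C_E[OF q(1)] by blast
    have "\<forall>\<^sub>F d in at_right 0. (\<lambda>n. g y (\<theta> n + (t + d))) \<longlonglongrightarrow> g (h q) (t + d)"
    proof (rule tendsto_shift_of_comparable[OF q(2) \<theta> _ t])
      fix k :: "nat \<Rightarrow> nat" and \<delta> :: "nat \<Rightarrow> real"
      assume \<delta>: "\<And>n. 0 \<le> \<delta> n" and lim: "(\<lambda>n. f x (\<theta> (k n) + \<delta> n)) \<longlonglongrightarrow> q"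
      show "(\<lambda>n. g y (\<theta> (k n) + \<delta> n)) \<longlonglongrightarrow> h q"
        by (rule h[OF q(1) _ lim]) (use \<theta> \<delta> in \<open>simp add: add_nonneg_nonneg\<close>)
    qed
    moreover have "\<forall>\<^sub>F d in at_right 0. d > (0::real)" by (simp add: eventually_at_filter)
    moreover note X.impulsive_traj_isCont[OF t q(2)]
    ultimately have ev: "\<forall>\<^sub>F d in at_right 0. f q (t + d) \<in> C \<and> h (f q (t + d)) = g (h q) (t + d)"
    proof eventually_elim
      case (elim d)
      have "(\<lambda>n. (f x (\<theta> n), t + d)) \<longlonglongrightarrow> (q, t + d)" by (intro tendsto_Pair \<theta> tendsto_const)
      from isCont_tendsto_compose[OF elim(3) this]
      have lim: "(\<lambda>n. f x (\<theta> n + (t + d))) \<longlonglongrightarrow> f q (t + d)"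
        using \<theta>(1) t elim(2) by (simp add: X.impulsive_traj_add)
      have nn: "0 \<le> \<theta> n + (t + d)" for n using \<theta>(1)[of n] t elim(2) by linarith
      have mem: "f q (t + d) \<in> C" using C_I[OF nn lim] .
      show ?case using LIMSEQ_unique[OF h[OF mem nn lim] elim(1)] mem by blast
    qed
    note f_lim = X.impulsive_traj_right_continuous[OF t, of q]
    have "f q t \<in> C"
      by (rule Lim_in_closed_set[OF _ _ _ f_lim])
        (use ev in \<open>auto simp: C_def elim: eventually_mono\<close>)
    then have "((\<lambda>d. h (f q (t + d))) \<longlongrightarrow> h (f q t)) (at_right 0)"
      by (rule continuous_on_tendsto_compose[OF h_cont f_lim])
        (use ev in \<open>auto elim: eventually_mono\<close>)
    moreover have "\<forall>\<^sub>F d in at_right 0. h (f q (t + d)) = g (h q) (t + d)"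
      using ev by eventually_elim blast
    ultimately have "((\<lambda>d. g (h q) (t + d)) \<longlongrightarrow> h (f q t)) (at_right 0)"
      by (rule Lim_transform_eventually)
    then show ?thesis
      using tendsto_unique[OF trivial_limit_at_right_real _ Y.impulsive_traj_right_continuous[OF t]]
      by blast
  qed
  then have "\<forall>q\<in>C - M\<^sub>X. \<forall>t\<ge>0. h (f q t) = g (h q) t" by blast
  then show ?thesis using h_cont h_image h_x unfolding C_def by (intro exI[of _ h] conjI)
qed

end

theorem theorem4p12:
  fixes \<pi> :: "'a::metric_space \<Rightarrow> real \<Rightarrow> 'a" and M\<^sub>X :: "'a set" and I\<^sub>X :: "'a \<Rightarrow> 'a"
    and \<sigma> :: "'b::metric_space \<Rightarrow> real \<Rightarrow> 'b" and M\<^sub>Y :: "'b set" and I\<^sub>Y :: "'b \<Rightarrow> 'b"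
    and x :: 'a and y :: 'b
  defines "\<pi>t \<equiv> impulsive_traj \<pi> M\<^sub>X I\<^sub>X"
    and "\<sigma>t \<equiv> impulsive_traj \<sigma> M\<^sub>Y I\<^sub>Y"
  assumes "standing_impulsive_system \<pi> M\<^sub>X I\<^sub>X"
    and "standing_impulsive_system \<sigma> M\<^sub>Y I\<^sub>Y"
    and "x \<notin> M\<^sub>X"
    and "almost_periodic \<pi>t x"
  shows "(strongly_comparable \<sigma>t y \<pi>t x \<longleftrightarrow> conv_times \<pi>t x \<subseteq> conv_times \<sigma>t y)
       \<and> ((\<exists>h. continuous_on (closure (positive_orbit \<pi>t x)) h
               \<and> h ` closure (positive_orbit \<pi>t x) \<subseteq> closure (positive_orbit \<sigma>t y)
               \<and> (\<forall>q \<in> closure (positive_orbit \<pi>t x) - M\<^sub>X. \<forall>t\<ge>0. h (\<pi>t q t) = \<sigma>t (h q) t)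
               \<and> h x = y)
           \<longleftrightarrow> conv_times \<pi>t x \<subseteq> conv_times \<sigma>t y)"
proof -
  interpret impulsive_system_pair \<pi> M\<^sub>X I\<^sub>X \<sigma> M\<^sub>Y I\<^sub>Y
    using assms(3,4) by (rule impulsive_system_pair.intro)
  \<comment> \<open>Being in the orbit closure and off \<open>M\<^sub>X\<close>, the point
    \<open>x\<close> may serve as \<open>q\<close> in (b), which yields the identity along its
    orbit.\<close>
  have x: "x \<in> closure (positive_orbit \<pi>t x) - M\<^sub>X"
    using assms(5) closure_subset X.impulsive_traj_zero[of x]
    unfolding \<pi>t_def positive_orbit_def by force
  have "strongly_comparable \<sigma>t y \<pi>t x \<longleftrightarrow> conv_times \<pi>t x \<subseteq> conv_times \<sigma>t y"
    using strongly_comparable_imp_subset subset_imp_strongly_comparable assms(5,6)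
    unfolding \<pi>t_def \<sigma>t_def by blast
  moreover have semi: "conv_times \<pi>t x \<subseteq> conv_times \<sigma>t y"
    if "continuous_on (closure (positive_orbit \<pi>t x)) h"
      "\<forall>q \<in> closure (positive_orbit \<pi>t x) - M\<^sub>X. \<forall>t\<ge>0. h (\<pi>t q t) = \<sigma>t (h q) t" "h x = y" for h
    by (rule conv_times_semiconjugate[OF that(1)]) (use that(2,3) x in blast)
  ultimately show ?thesis
  proof (intro conjI iffI, goal_cases)
    case 3
    then show ?case using semi by (elim exE conjE)
  next
    case 4
    then show ?case unfolding \<pi>t_def \<sigma>t_def by (intro subset_imp_semiconjugate)
  qed simp_all
qed

end
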